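(* Let $n \ge 1$, and suppose $\mathbf{X}=(X_1,\ldots,X_n)$ and $\mathbf{Y}=(Y_1,\ldots,Y_n)$ are random vectors in $\mathbb{R}^n$ with $\mathbf{Y}$ having independent components. For $1 \le i \le n$, let $$A_i := \mathbb{E}\left|\mathbb{E}(X_i \mid X_1,\ldots,X_{i-1}) - \mathbb{E}(Y_i)\right|,$$ $$B_i := \mathbb{E}\left|\mathbb{E}(X_i^2 \mid X_1,\ldots,X_{i-1}) - \mathbb{E}(Y_i^2)\right|.$$ Let $M_3$ be a (finite) bound on $\max_{1\le i\le n}(\mathbb{E}|X_i|^3 + \mathbb{E}|Y_i|^3)$. Suppose $f:\mathbb{R}^n \to \mathbb{R}$ is a thrice continuously differentiable function, and for $r = 1,2,3$, let $L_r(f)$ be a finite constant such that $|\partial_i^r f(\mathbf{x})| \le L_r(f)$ for each $i\in\{1,\ldots,n\}$ and each $\mathbf{x}\in\mathbb{R}^n$, where $\partial_i^r$ denotes the $r$-fold derivative in the $i$th coordinate. Then $$|\mathbb{E}f(\mathbf{X}) - \mathbb{E}f(\mathbf{Y})| \le \sum_{i=1}^n \left(A_i L_1(f) + \tfrac{1}{2} B_i L_2(f)\right) + \tfrac{1}{6}\, n\, L_3(f)\, M_3.$$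
   Context: For $i=1$ the conditional expectation given $X_1,\ldots,X_{i-1}$ is the unconditional expectation. No independence is assumed among the components of $\mathbf{X}$. *)

theory Defs
  imports "HOL-Analysis.Analysis" "HOL-Probability.Probability"
begin

definition partial_deriv :: "'n::finite \<Rightarrow> (real^'n \<Rightarrow> real) \<Rightarrow> real^'n \<Rightarrow> real" where
  "partial_deriv i f x = deriv (\<lambda>t. f (x + t *\<^sub>R axis i 1)) 0"

primrec k_times_cont_diff :: "nat \<Rightarrow> (real^'n::finite \<Rightarrow> real) \<Rightarrow> bool" where
  "k_times_cont_diff 0 f \<longleftrightarrow> continuous_on UNIV f"
| "k_times_cont_diff (Suc k) f \<longleftrightarrow>
     continuous_on UNIV f \<and>
     (\<forall>i. (\<forall>x. (\<lambda>t. f (x + t *\<^sub>R axis i 1)) differentiable (at 0)) \<and>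
          k_times_cont_diff k (partial_deriv i f))"

text \<open>The \<open>\<sigma>\<close>-algebra on \<^term>\<open>space M\<close> generated by the coordinates of \<open>X\<close> preceding \<open>i\<close>. For the
  least index the generating family is empty and the trivial \<open>\<sigma>\<close>-algebra results, so that
  conditioning on it gives the unconditional expectation (lemma below).\<close>

definition past_algebra ::
    "'a measure \<Rightarrow> ('a \<Rightarrow> real^'n::{finite,linorder}) \<Rightarrow> 'n \<Rightarrow> 'a measure" where
  "past_algebra M X i =
     sigma (space M) {(\<lambda>\<omega>. X \<omega> $ j) -` S \<inter> space M | j S. j < i \<and> S \<in> sets borel}"

lemma (in prob_space) cond_exp_past_algebra_least:
  fixes X :: "'a \<Rightarrow> real^'n::{finite,linorder}"
  assumes least: "\<And>j. \<not> j < i" and g: "integrable M g"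
  shows "AE \<omega> in M. real_cond_exp M (past_algebra M X i) g \<omega> = expectation g"
proof -
  have sets: "sets (past_algebra M X i) = {{}, space M}"
    using least by (simp add: past_algebra_def sigma_sets_empty_eq)
  have sub: "subalgebra M (past_algebra M X i)"
    unfolding subalgebra_def using sets by (auto simp: past_algebra_def space_measure_of_conv)
  interpret finite_measure_subalgebra M "past_algebra M X i"
    by standard (rule sub)
  show ?thesis
  proof (rule real_cond_exp_charact)
    fix S assume "S \<in> sets (past_algebra M X i)"
    then have "S = {} \<or> S = space M" using sets by simp
    then show "(\<integral>x\<in>S. g x \<partial>M) = (\<integral>x\<in>S. expectation g \<partial>M)"
    proof
      assume "S = {}"
      then show ?thesis by (simp add: set_lebesgue_integral_def)
    next
      assume "S = space M"
      then show ?thesis using g by (simp add: set_integral_space prob_space)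
    qed
  qed (use g in auto)
qed

end

theory Submission
  imports Defs
begin

text \<open>Lindeberg's replacement argument on the product space, where \<open>X\<close> and \<open>Y\<close> are independent. The
  coordinates of \<open>Y\<close> are exchanged for those of \<open>X\<close> in increasing order; when coordinate \<open>b\<close> is
  exchanged, both hybrid vectors are Taylor expanded around their common vector \<open>W\<close> with
  coordinate \<open>b\<close> set to zero. For fixed \<open>Y\<close>, \<open>W\<close> depends only on the past of \<open>X\<close>, so the moments of
  \<open>X\<^sub>b\<close> may be replaced by conditional moments; for fixed \<open>X\<close>, \<open>W\<close> is independent of \<open>Y\<^sub>b\<close>. The
  first two orders thus contribute \<open>A\<^sub>b L\<^sub>1 + B\<^sub>b L\<^sub>2 / 2\<close>, and the remainders the third moments.\<close>

section \<open>Hybrid vectors and coordinatewise measurability\<close>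

text \<open>\<open>A\<close> records the coordinates exchanged so far: \<open>{}\<close> gives
  \<open>y\<close> and \<open>UNIV\<close> gives \<open>x\<close>. A set in place of an index bound
  allows induction over the subsets of any finite linear order.\<close>

definition merge_vec :: "'n set \<Rightarrow> real^'n::finite \<Rightarrow> real^'n \<Rightarrow> real^'n" where
  "merge_vec A x y = (\<chi> j. if j \<in> A then x $ j else y $ j)"

definition zero_coord :: "'n \<Rightarrow> real^'n::finite \<Rightarrow> real^'n" where
  "zero_coord i x = (\<chi> j. if j = i then 0 else x $ j)"

lemma borel_measurable_vec_iff:
  fixes F :: "'a \<Rightarrow> real^'n::finite"
  shows "F \<in> borel_measurable M \<longleftrightarrow> (\<forall>i. (\<lambda>\<omega>. F \<omega> $ i) \<in> borel_measurable M)"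
proof -
  have "F \<in> borel_measurable M \<longleftrightarrow> (\<forall>i\<in>Basis. (\<lambda>\<omega>. F \<omega> \<bullet> i) \<in> borel_measurable M)"
    by (rule borel_measurable_euclidean_space)
  also have "\<dots> \<longleftrightarrow> (\<forall>i. (\<lambda>\<omega>. F \<omega> $ i) \<in> borel_measurable M)"
    by (auto simp: Basis_vec_def inner_axis)
  finally show ?thesis .
qed

lemma add_scaleR_zero_coord: "zero_coord i x + (x $ i) *\<^sub>R axis i 1 = x"
  by (auto simp: zero_coord_def vec_eq_iff axis_def)

text \<open>The hybrids before and after the exchange of coordinate \<open>i\<close> differ only
  there, so they share one expansion point.\<close>

lemma zero_coord_merge_vec_insert:
  "i \<notin> A \<Longrightarrow> zero_coord i (merge_vec (insert i A) x y) = zero_coord i (merge_vec A x y)"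
  by (auto simp: zero_coord_def merge_vec_def vec_eq_iff)

section \<open>Derivatives along a coordinate axis\<close>

text \<open>Since \<open>partial_deriv\<close> is a derivative at parameter 0, the base point is
  moved along the axis to reach an arbitrary \<open>t\<close>.\<close>

lemma partial_deriv_has_real_derivative:
  assumes "\<And>x. (\<lambda>t. f (x + t *\<^sub>R axis i 1)) differentiable (at 0)"
  shows "((\<lambda>t. f (x + t *\<^sub>R axis i 1)) has_real_derivative partial_deriv i f (x + t *\<^sub>R axis i 1)) (at t)"
proof -
  have "((\<lambda>s. f (x + t *\<^sub>R axis i 1 + s *\<^sub>R axis i 1)) has_real_derivative
      partial_deriv i f (x + t *\<^sub>R axis i 1)) (at 0)"
    unfolding partial_deriv_def
    using assms[of "x + t *\<^sub>R axis i 1"] by (simp add: DERIV_deriv_iff_real_differentiable)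
  then have "((\<lambda>s. f (x + (s + t) *\<^sub>R axis i 1)) has_real_derivative
      partial_deriv i f (x + t *\<^sub>R axis i 1)) (at 0)"
    by (simp add: algebra_simps)
  then show ?thesis
    using DERIV_shift[of "\<lambda>s. f (x + s *\<^sub>R axis i 1)" _ 0 t] by simp
qed

lemma k_times_cont_diff_imp_continuous: "k_times_cont_diff k f \<Longrightarrow> continuous_on UNIV f"
  by (cases k) auto

lemma k_times_cont_diff_funpow_partial_deriv:
  "k_times_cont_diff (m + k) f \<Longrightarrow> k_times_cont_diff k ((partial_deriv i ^^ m) f)"
  by (induction m arbitrary: f) (auto simp: funpow_swap1)

text \<open>On the line through \<open>x\<close> in direction \<open>i\<close>, the
  \<open>m\<close>-th derivative of \<open>f\<close> is the iterated pure partial derivative, so the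
  one-variable Maclaurin formula with Lagrange remainder applies. The location of \<open>s\<close>
  is dropped, as the derivative bounds hold on the whole space.\<close>

lemma partial_deriv_Maclaurin:
  fixes f :: "real^'n::finite \<Rightarrow> real"
  assumes "k_times_cont_diff k f"
  obtains s where "f (x + t *\<^sub>R axis i 1) =
     (\<Sum>m<k. (partial_deriv i ^^ m) f x / fact m * t ^ m)
       + (partial_deriv i ^^ k) f (x + s *\<^sub>R axis i 1) / fact k * t ^ k"
proof -
  let ?d = "\<lambda>m t. (partial_deriv i ^^ m) f (x + t *\<^sub>R axis i 1)"
  have "DERIV (?d m) s :> ?d (Suc m) s" if "m < k" for m s
  proof -
    have "k_times_cont_diff (Suc (k - Suc m)) ((partial_deriv i ^^ m) f)"
      using that assms by (intro k_times_cont_diff_funpow_partial_deriv) simp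
    then show ?thesis
      using partial_deriv_has_real_derivative[of "(partial_deriv i ^^ m) f" i x s] by simp
  qed
  then have "\<exists>s. \<bar>s\<bar> \<le> \<bar>t\<bar> \<and> ?d 0 t = (\<Sum>m<k. ?d m 0 / fact m * t ^ m) + ?d k s / fact k * t ^ k"
    by (intro Maclaurin_bi_le) auto
  then show ?thesis using that by auto
qed

section \<open>The sigma-algebra of the past\<close>

lemma subalgebra_past_algebra:
  assumes [measurable]: "X \<in> borel_measurable M"
  shows "subalgebra M (past_algebra M X i)"
proof -
  have "(\<lambda>\<omega>. X \<omega> $ j) \<in> borel_measurable M" for j
    using assms by (simp add: borel_measurable_vec_iff)
  then have "{(\<lambda>\<omega>. X \<omega> $ j) -` S \<inter> space M | j S. j < i \<and> S \<in> sets borel} \<subseteq> sets M"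
    by (auto intro: measurable_sets)
  then show ?thesis
    unfolding subalgebra_def past_algebra_def
    by (auto simp: space_measure_of_conv sets_measure_of_conv intro: sets.sigma_sets_subset[THEN subsetD])
qed

lemma measurable_past_algebra_nth:
  assumes "j < i"
  shows "(\<lambda>\<omega>. X \<omega> $ j) \<in> borel_measurable (past_algebra M X i)"
proof (rule measurableI)
  fix S :: "real set" assume "S \<in> sets borel"
  then have "(\<lambda>\<omega>. X \<omega> $ j) -` S \<inter> space M
      \<in> sigma_sets (space M) {(\<lambda>\<omega>. X \<omega> $ j) -` S \<inter> space M | j S. j < i \<and> S \<in> sets borel}"
    using assms by (intro sigma_sets.Basic) auto
  moreover have "{(\<lambda>\<omega>. X \<omega> $ j) -` S \<inter> space M | j S. j < i \<and> S \<in> sets borel} \<subseteq> Pow (space M)"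
    by auto
  ultimately show "(\<lambda>\<omega>. X \<omega> $ j) -` S \<inter> space (past_algebra M X i) \<in> sets (past_algebra M X i)"
    by (simp add: past_algebra_def space_measure_of_conv)
qed auto

section \<open>Marginals of the product measure\<close>

lemma (in pair_prob_space)
  fixes g :: "'a \<Rightarrow> real"
  assumes "g \<in> borel_measurable M1"
  shows integrable_fst_iff: "integrable (M1 \<Otimes>\<^sub>M M2) (\<lambda>z. g (fst z)) \<longleftrightarrow> integrable M1 g"
    and integral_comp_fst: "(\<integral>z. g (fst z) \<partial>(M1 \<Otimes>\<^sub>M M2)) = (\<integral>x. g x \<partial>M1)"
  using assms integrable_distr_eq[of fst "M1 \<Otimes>\<^sub>M M2" M1 g] integral_distr[of fst "M1 \<Otimes>\<^sub>M M2" M1 g]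
  by (simp_all add: M2.distr_pair_fst)

text \<open>Swapping the factors reduces the second marginal to the first.\<close>

lemma (in pair_prob_space) distr_pair_snd: "distr (M1 \<Otimes>\<^sub>M M2) M2 snd = M2"
proof -
  have "distr (M1 \<Otimes>\<^sub>M M2) M2 snd = distr (distr (M2 \<Otimes>\<^sub>M M1) (M1 \<Otimes>\<^sub>M M2) (\<lambda>(x, y). (y, x))) M2 snd"
    by (subst distr_pair_swap) (rule refl)
  also have "\<dots> = distr (M2 \<Otimes>\<^sub>M M1) M2 fst"
    by (subst distr_distr) (auto intro!: distr_cong)
  finally show ?thesis by (simp add: M1.distr_pair_fst)
qed

lemma (in pair_prob_space)
  fixes g :: "'b \<Rightarrow> real"
  assumes "g \<in> borel_measurable M2"
  shows integrable_snd_iff: "integrable (M1 \<Otimes>\<^sub>M M2) (\<lambda>z. g (snd z)) \<longleftrightarrow> integrable M2 g"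
    and integral_comp_snd: "(\<integral>z. g (snd z) \<partial>(M1 \<Otimes>\<^sub>M M2)) = (\<integral>x. g x \<partial>M2)"
  using assms integrable_distr_eq[of snd "M1 \<Otimes>\<^sub>M M2" M2 g] integral_distr[of snd "M1 \<Otimes>\<^sub>M M2" M2 g]
  by (simp_all add: distr_pair_snd)

section \<open>Growth, Taylor and moment estimates\<close>

text \<open>Starting from 0, the coordinates of \<open>x\<close> are switched on one at a time; by
  the mean value theorem along an axis each switch costs at most \<open>L\<close> times the size of
  that coordinate. This linear growth later makes \<open>f\<close> integrable along the
  hybrids.\<close>

lemma abs_diff_zero_le_sum_partial_deriv:
  fixes f :: "real^'n::finite \<Rightarrow> real"
  assumes f: "k_times_cont_diff 1 f" and L: "\<And>i x. \<bar>partial_deriv i f x\<bar> \<le> L"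
  shows "\<bar>f x - f 0\<bar> \<le> L * (\<Sum>i\<in>UNIV. \<bar>x $ i\<bar>)"
proof -
  have "\<bar>f (merge_vec S x 0) - f 0\<bar> \<le> L * (\<Sum>i\<in>S. \<bar>x $ i\<bar>)" if "finite S" for S
    using that
  proof (induction S)
    case empty
    then show ?case by (simp add: merge_vec_def zero_vec_def)
  next
    case (insert i S)
    have eq: "merge_vec (insert i S) x 0 = merge_vec S x 0 + (x $ i) *\<^sub>R axis i 1"
      using insert.hyps by (auto simp: merge_vec_def vec_eq_iff axis_def)
    obtain s where "f (merge_vec (insert i S) x 0) =
        f (merge_vec S x 0) + partial_deriv i f (merge_vec S x 0 + s *\<^sub>R axis i 1) * x $ i"
      using partial_deriv_Maclaurin[OF f, of "merge_vec S x 0" "x $ i" i] unfolding eq by auto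
    moreover have "\<bar>partial_deriv i f (merge_vec S x 0 + s *\<^sub>R axis i 1) * x $ i\<bar> \<le> L * \<bar>x $ i\<bar>"
      unfolding abs_mult by (intro mult_right_mono L) simp
    ultimately show ?case using insert by (simp add: algebra_simps)
  qed
  from this[of UNIV] show ?thesis by (simp add: merge_vec_def)
qed

text \<open>Lagrange remainder of order three. The lower terms are written as a power of
  \<open>t\<close> times a function of \<open>x\<close>, the shape to which the moment comparison
  applies.\<close>

lemma partial_deriv_Taylor2_bound:
  fixes f :: "real^'n::finite \<Rightarrow> real"
  assumes "k_times_cont_diff 3 f" and L: "\<And>x. \<bar>(partial_deriv i ^^ 3) f x\<bar> \<le> L"
  shows "\<bar>f (x + t *\<^sub>R axis i 1) - f x - t * partial_deriv i f x
            - t\<^sup>2 * ((partial_deriv i ^^ 2) f x / 2)\<bar> \<le> L / 6 * \<bar>t\<bar> ^ 3"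
proof -
  obtain s where s: "f (x + t *\<^sub>R axis i 1) =
     (\<Sum>m<3. (partial_deriv i ^^ m) f x / fact m * t ^ m)
       + (partial_deriv i ^^ 3) f (x + s *\<^sub>R axis i 1) / fact 3 * t ^ 3"
    using partial_deriv_Maclaurin[OF assms(1)] .
  have "f (x + t *\<^sub>R axis i 1) - f x - t * partial_deriv i f x - t\<^sup>2 * ((partial_deriv i ^^ 2) f x / 2)
      = (partial_deriv i ^^ 3) f (x + s *\<^sub>R axis i 1) / 6 * t ^ 3"
    unfolding s by (simp add: lessThan_nat_numeral eval_nat_numeral)
  moreover have "\<bar>(partial_deriv i ^^ 3) f (x + s *\<^sub>R axis i 1) / 6 * t ^ 3\<bar> \<le> L / 6 * \<bar>t\<bar> ^ 3"
    unfolding abs_mult power_abs using L by (intro mult_right_mono) auto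
  ultimately show ?thesis by (simp only:)
qed

text \<open>Domination by \<open>1 + \<bar>Z \<omega>\<bar> ^ n\<close>, which is integrable since
  the total mass is finite. Third absolute moments thus yield the first two moments.\<close>

lemma (in prob_space) integrable_power_le:
  fixes Z :: "'a \<Rightarrow> real"
  assumes [measurable]: "Z \<in> borel_measurable M"
    and int: "integrable M (\<lambda>\<omega>. \<bar>Z \<omega>\<bar> ^ n)" and "m \<le> n"
  shows "integrable M (\<lambda>\<omega>. Z \<omega> ^ m)"
proof (rule Bochner_Integration.integrable_bound)
  show "integrable M (\<lambda>\<omega>. 1 + \<bar>Z \<omega>\<bar> ^ n)" using int by simp
  have "\<bar>t\<bar> ^ m \<le> 1 + \<bar>t\<bar> ^ n" for t :: real
  proof (cases "\<bar>t\<bar> \<le> 1")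
    case True
    then have "\<bar>t\<bar> ^ m \<le> 1" by (simp add: power_le_one)
    then show ?thesis by (simp add: add_increasing2)
  next
    case False
    then have "\<bar>t\<bar> ^ m \<le> \<bar>t\<bar> ^ n" using \<open>m \<le> n\<close> by (intro power_increasing) auto
    then show ?thesis by simp
  qed
  then show "AE \<omega> in M. norm (Z \<omega> ^ m) \<le> norm (1 + \<bar>Z \<omega>\<bar> ^ n)"
    by (simp add: power_abs)
qed simp

section \<open>Exchange of one coordinate on the product space\<close>

locale random_vector_pair = pair_prob_space M1 M2
  for M1 :: "'a measure" and M2 :: "'b measure" +
  fixes X :: "'a \<Rightarrow> real^'n::{finite,linorder}" and Y :: "'b \<Rightarrow> real^'n::{finite,linorder}"
  assumes X_meas: "X \<in> borel_measurable M1" and Y_meas: "Y \<in> borel_measurable M2"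
    and indep_Y: "M2.indep_vars (\<lambda>_. borel) (\<lambda>i \<omega>. Y \<omega> $ i) UNIV"
begin

abbreviation hybrid :: "'n set \<Rightarrow> 'a \<times> 'b \<Rightarrow> real^'n::{finite,linorder}" where
  "hybrid A z \<equiv> merge_vec A (X (fst z)) (Y (snd z))"

lemma X_nth_measurable [measurable]: "(\<lambda>\<omega>. X \<omega> $ j) \<in> borel_measurable M1"
  using X_meas by (simp add: borel_measurable_vec_iff)

lemma Y_nth_measurable [measurable]: "(\<lambda>\<omega>. Y \<omega> $ j) \<in> borel_measurable M2"
  using Y_meas by (simp add: borel_measurable_vec_iff)

lemma hybrid_measurable [measurable]: "hybrid A \<in> borel_measurable (M1 \<Otimes>\<^sub>M M2)"
  unfolding borel_measurable_vec_iff by (auto simp: merge_vec_def)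

lemma zero_coord_hybrid_measurable [measurable]:
  "(\<lambda>z. zero_coord b (hybrid A z)) \<in> borel_measurable (M1 \<Otimes>\<^sub>M M2)"
  unfolding borel_measurable_vec_iff zero_coord_def merge_vec_def vec_lambda_beta by auto

text \<open>With \<open>x\<close> fixed and coordinate \<open>b\<close> set to zero, the argument of
  \<open>g\<close> depends only on the components of \<open>Y\<close> other than \<open>b\<close>,
  hence is independent of the component \<open>b\<close>; the expectation of the product
  factors.\<close>

lemma indep_coord_zero_coord:
  fixes h :: "real \<Rightarrow> real" and g :: "real^'n::{finite,linorder} \<Rightarrow> real"
  assumes [measurable]: "h \<in> borel_measurable borel" "g \<in> borel_measurable borel"
    and h: "integrable M2 (\<lambda>\<eta>. h (Y \<eta> $ b))" and g: "\<And>x. \<bar>g x\<bar> \<le> C"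
  shows "(\<integral>\<eta>. h (Y \<eta> $ b) * g (zero_coord b (merge_vec A x (Y \<eta>))) \<partial>M2)
       = (\<integral>\<eta>. h (Y \<eta> $ b) \<partial>M2) * (\<integral>\<eta>. g (zero_coord b (merge_vec A x (Y \<eta>))) \<partial>M2)"
proof -
  have W [measurable]: "(\<lambda>\<eta>. zero_coord b (merge_vec A x (Y \<eta>))) \<in> borel_measurable M2"
    unfolding borel_measurable_vec_iff zero_coord_def merge_vec_def vec_lambda_beta by auto
  \<comment> \<open>\<open>?G\<close> rebuilds the weight from the block \<open>UNIV - {b}\<close>
    alone, so it composes with the restriction of \<open>Y\<close> to that block.\<close>
  let ?G = "\<lambda>p. g (\<chi> j. if j = b then 0 else if j \<in> A then x $ j else p j)"
  have "(\<lambda>p. if j = b then 0 else if j \<in> A then x $ j else p j)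
      \<in> borel_measurable (PiM (UNIV - {b}) (\<lambda>_. borel))" for j
    by (cases "j = b"; cases "j \<in> A") simp_all
  then have "(\<lambda>p. \<chi> j. if j = b then 0 else if j \<in> A then x $ j else p j)
      \<in> borel_measurable (PiM (UNIV - {b}) (\<lambda>_. borel))"
    unfolding borel_measurable_vec_iff vec_lambda_beta by blast
  then have "M2.indep_var borel ((\<lambda>p. h (p b)) \<circ> (\<lambda>\<eta>. restrict (\<lambda>i. Y \<eta> $ i) {b}))
      borel (?G \<circ> (\<lambda>\<eta>. restrict (\<lambda>i. Y \<eta> $ i) (UNIV - {b})))"
    by (intro M2.indep_var_compose[OF M2.indep_var_restrict[OF indep_Y]]) auto
  also have "(\<lambda>p. h (p b)) \<circ> (\<lambda>\<eta>. restrict (\<lambda>i. Y \<eta> $ i) {b}) = (\<lambda>\<eta>. h (Y \<eta> $ b))"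
    by auto
  also have "?G \<circ> (\<lambda>\<eta>. restrict (\<lambda>i. Y \<eta> $ i) (UNIV - {b}))
      = (\<lambda>\<eta>. g (zero_coord b (merge_vec A x (Y \<eta>))))"
    by (auto simp: fun_eq_iff zero_coord_def merge_vec_def vec_eq_iff intro!: arg_cong[of _ _ g])
  finally show ?thesis
    using h g by (intro M2.indep_var_lebesgue_integral) (auto intro: M2.integrable_const_bound[of _ C])
qed

text \<open>The weight \<open>g\<close> is evaluated at a point free of coordinate \<open>b\<close>.
  Inside the integral against it, \<open>h\<close> of the component \<open>b\<close> of
  \<open>X\<close> can be replaced by its conditional expectation given the past, and
  \<open>h\<close> of that of \<open>Y\<close> by its mean; bounding the weight by \<open>C\<close>
  then finishes. A general \<open>h\<close> covers both the identity and the square.\<close>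

lemma hybrid_moment_bound:
  assumes A: "\<forall>a\<in>A. a < b"
    and h_meas [measurable]: "h \<in> borel_measurable borel" and g_meas [measurable]: "g \<in> borel_measurable borel"
    and hX: "integrable M1 (\<lambda>\<omega>. h (X \<omega> $ b))" and hY: "integrable M2 (\<lambda>\<eta>. h (Y \<eta> $ b))"
    and g: "\<And>x. \<bar>g x\<bar> \<le> C"
  defines "D \<equiv> \<lambda>z. (h (X (fst z) $ b) - h (Y (snd z) $ b)) * g (zero_coord b (hybrid A z))"
  shows "integrable (M1 \<Otimes>\<^sub>M M2) D"
    and "\<bar>expectation D\<bar> \<le>
      M1.expectation (\<lambda>\<omega>. \<bar>real_cond_exp M1 (past_algebra M1 X b) (\<lambda>\<omega>. h (X \<omega> $ b)) \<omega>
        - M2.expectation (\<lambda>\<eta>. h (Y \<eta> $ b))\<bar>) * C"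
proof -
  let ?P = "M1 \<Otimes>\<^sub>M M2" and ?F = "past_algebra M1 X b"
  define G where "G = (\<lambda>z. g (zero_coord b (hybrid A z)))"
  define ce where "ce = real_cond_exp M1 ?F (\<lambda>\<omega>. h (X \<omega> $ b))"
  define m where "m = M2.expectation (\<lambda>\<eta>. h (Y \<eta> $ b))"
  interpret F: finite_measure_subalgebra M1 ?F
    by standard (rule subalgebra_past_algebra[OF X_meas])
  have C: "C \<ge> 0" using g[of 0] by linarith
  have G_meas [measurable]: "G \<in> borel_measurable ?P" unfolding G_def by measurable
  have ce_int: "integrable M1 ce" unfolding ce_def by (intro F.real_cond_exp_int hX)
  then have [measurable]: "ce \<in> borel_measurable M1" by simp
  \<comment> \<open>A weight bounded by \<open>C\<close> preserves integrability.\<close>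
  have mult_G: "integrable ?P (\<lambda>z. u z * G z)" if u: "integrable ?P u" for u
  proof (rule Bochner_Integration.integrable_bound)
    show "integrable ?P (\<lambda>z. C * u z)" using u by simp
    show "(\<lambda>z. u z * G z) \<in> borel_measurable ?P" using u by measurable
    have "\<bar>u z\<bar> * \<bar>G z\<bar> \<le> C * \<bar>u z\<bar>" for z
      unfolding G_def by (subst mult.commute) (intro mult_right_mono g, simp)
    then show "AE z in ?P. norm (u z * G z) \<le> norm (C * u z)"
      using C by (simp add: abs_mult)
  qed
  have iX: "integrable ?P (\<lambda>z. h (X (fst z) $ b) * G z)"
    using hX integrable_fst_iff[of "\<lambda>\<omega>. h (X \<omega> $ b)"] by (intro mult_G) simp
  have iY: "integrable ?P (\<lambda>z. h (Y (snd z) $ b) * G z)"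
    using hY integrable_snd_iff[of "\<lambda>\<omega>. h (Y \<omega> $ b)"] by (intro mult_G) simp
  have ice: "integrable ?P (\<lambda>z. ce (fst z) * G z)"
    using ce_int integrable_fst_iff[of ce] by (intro mult_G) simp
  have im: "integrable ?P (\<lambda>z. m * G z)" by (intro mult_G) simp
  have D: "D = (\<lambda>z. h (X (fst z) $ b) * G z - h (Y (snd z) $ b) * G z)"
    by (auto simp: D_def G_def algebra_simps)
  show "integrable ?P D" unfolding D using iX iY by simp
  \<comment> \<open>With \<open>\<eta>\<close> fixed, \<open>G\<close> sees \<open>X\<close> only
    through the coordinates in \<open>A\<close>, all of which precede \<open>b\<close>.\<close>
  have G_past: "(\<lambda>\<omega>. G (\<omega>, \<eta>)) \<in> borel_measurable ?F" for \<eta>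
  proof -
    have "(\<lambda>\<omega>. X \<omega> $ j) \<in> borel_measurable ?F" if "j \<in> A" for j
      using A that by (intro measurable_past_algebra_nth) simp
    then have "(\<lambda>\<omega>. zero_coord b (merge_vec A (X \<omega>) (Y \<eta>)) $ i) \<in> borel_measurable ?F" for i
      by (cases "i = b"; cases "i \<in> A") (simp_all add: zero_coord_def merge_vec_def)
    then have "(\<lambda>\<omega>. zero_coord b (merge_vec A (X \<omega>) (Y \<eta>))) \<in> borel_measurable ?F"
      unfolding borel_measurable_vec_iff by blast
    then show ?thesis unfolding G_def by simp
  qed
  \<comment> \<open>Fubini with \<open>\<eta>\<close> outermost: past measurability of the weight,
    and with it the replacement by \<open>ce\<close>, is available for each fixed
    \<open>\<eta>\<close>.\<close>
  have "(\<integral>z. h (X (fst z) $ b) * G z \<partial>?P) = (\<integral>\<eta>. (\<integral>\<omega>. h (X \<omega> $ b) * G (\<omega>, \<eta>) \<partial>M1) \<partial>M2)"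
    using integral_snd[of "\<lambda>\<omega> \<eta>. h (X \<omega> $ b) * G (\<omega>, \<eta>)"] iX by (simp add: case_prod_beta')
  also have "\<dots> = (\<integral>\<eta>. (\<integral>\<omega>. ce \<omega> * G (\<omega>, \<eta>) \<partial>M1) \<partial>M2)"
  proof (rule Bochner_Integration.integral_cong[OF refl])
    fix \<eta>
    have "integrable M1 (\<lambda>\<omega>. G (\<omega>, \<eta>) * h (X \<omega> $ b))"
    proof (rule Bochner_Integration.integrable_bound)
      show "integrable M1 (\<lambda>\<omega>. C * h (X \<omega> $ b))" using hX by simp
      show "(\<lambda>\<omega>. G (\<omega>, \<eta>) * h (X \<omega> $ b)) \<in> borel_measurable M1"
        using measurable_from_subalg[OF F.subalg G_past[of \<eta>]] by measurable
      show "AE \<omega> in M1. norm (G (\<omega>, \<eta>) * h (X \<omega> $ b)) \<le> norm (C * h (X \<omega> $ b))"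
        using C g unfolding G_def by (auto simp: abs_mult intro!: mult_right_mono)
    qed
    \<comment> \<open>Defining property of conditional expectation, tested against the
      past-measurable weight.\<close>
    from F.real_cond_exp_intg(2)[OF this G_past]
    show "(\<integral>\<omega>. h (X \<omega> $ b) * G (\<omega>, \<eta>) \<partial>M1) = (\<integral>\<omega>. ce \<omega> * G (\<omega>, \<eta>) \<partial>M1)"
      by (simp add: ce_def mult.commute)
  qed
  also have "\<dots> = (\<integral>z. ce (fst z) * G z \<partial>?P)"
    using integral_snd[of "\<lambda>\<omega> \<eta>. ce \<omega> * G (\<omega>, \<eta>)"] ice by (simp add: case_prod_beta')
  finally have EX: "(\<integral>z. h (X (fst z) $ b) * G z \<partial>?P) = (\<integral>z. ce (fst z) * G z \<partial>?P)" .
  \<comment> \<open>Now \<open>\<omega>\<close> is outermost, because the factorization concerns the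
    components of \<open>Y\<close> with \<open>X\<close> held fixed.\<close>
  have "(\<integral>z. h (Y (snd z) $ b) * G z \<partial>?P) = (\<integral>\<omega>. (\<integral>\<eta>. h (Y \<eta> $ b) * G (\<omega>, \<eta>) \<partial>M2) \<partial>M1)"
    using integral_fst[of "\<lambda>\<omega> \<eta>. h (Y \<eta> $ b) * G (\<omega>, \<eta>)"] iY by (simp add: case_prod_beta')
  also have "\<dots> = (\<integral>\<omega>. (\<integral>\<eta>. m * G (\<omega>, \<eta>) \<partial>M2) \<partial>M1)"
    using indep_coord_zero_coord[OF h_meas g_meas hY g] by (simp add: G_def m_def)
  also have "\<dots> = (\<integral>z. m * G z \<partial>?P)"
    using integral_fst[of "\<lambda>\<omega> \<eta>. m * G (\<omega>, \<eta>)"] im by (simp add: case_prod_beta')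
  finally have EY: "(\<integral>z. h (Y (snd z) $ b) * G z \<partial>?P) = (\<integral>z. m * G z \<partial>?P)" .
  have icm: "integrable ?P (\<lambda>z. \<bar>ce (fst z) - m\<bar>)"
    using ce_int integrable_fst_iff[of "\<lambda>\<omega>. \<bar>ce \<omega> - m\<bar>"] by simp
  have "expectation D = (\<integral>z. (ce (fst z) - m) * G z \<partial>?P)"
    unfolding D left_diff_distrib using iX iY ice im EX EY
    \<comment> \<open>The rules moving constants out of integrals are disabled to keep
      \<open>m * G z\<close> in the form of \<open>im\<close> and \<open>EY\<close>.\<close>
    by (simp del: integral_mult_right_zero integral_mult_left_zero integral_mult_right integral_mult_left)
  also have "\<bar>\<dots>\<bar> \<le> (\<integral>z. \<bar>(ce (fst z) - m) * G z\<bar> \<partial>?P)"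
    by (rule integral_abs_bound)
  also have "\<dots> \<le> (\<integral>z. \<bar>ce (fst z) - m\<bar> * C \<partial>?P)"
  proof (rule integral_mono)
    show "integrable ?P (\<lambda>z. \<bar>(ce (fst z) - m) * G z\<bar>)"
      using ice im by (simp add: left_diff_distrib)
    show "integrable ?P (\<lambda>z. \<bar>ce (fst z) - m\<bar> * C)" using icm by simp
    show "\<bar>(ce (fst z) - m) * G z\<bar> \<le> \<bar>ce (fst z) - m\<bar> * C" for z
      unfolding abs_mult G_def by (intro mult_left_mono g) simp
  qed
  also have "\<dots> = (\<integral>\<omega>. \<bar>ce \<omega> - m\<bar> \<partial>M1) * C"
    using integral_comp_fst[of "\<lambda>\<omega>. \<bar>ce \<omega> - m\<bar>"] by simp
  finally show "\<bar>expectation D\<bar> \<le> M1.expectation (\<lambda>\<omega>. \<bar>real_cond_exp M1 ?F (\<lambda>\<omega>. h (X \<omega> $ b)) \<omega>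
        - M2.expectation (\<lambda>\<eta>. h (Y \<eta> $ b))\<bar>) * C"
    unfolding ce_def m_def .
qed

text \<open>Bounded first partial derivatives give at most linear growth, and each coordinate of a
  hybrid is a coordinate of \<open>X\<close> or of \<open>Y\<close>.\<close>

lemma integrable_hybrid:
  fixes f :: "real^'n::{finite,linorder} \<Rightarrow> real"
  assumes f: "k_times_cont_diff 1 f" and L: "\<And>i x. \<bar>partial_deriv i f x\<bar> \<le> L"
    and X: "\<And>i. integrable M1 (\<lambda>\<omega>. X \<omega> $ i)" and Y: "\<And>i. integrable M2 (\<lambda>\<omega>. Y \<omega> $ i)"
  shows "integrable (M1 \<Otimes>\<^sub>M M2) (\<lambda>z. f (hybrid A z))"
proof (rule Bochner_Integration.integrable_bound)
  let ?b = "\<lambda>z. \<bar>f 0\<bar> + L * (\<Sum>i\<in>UNIV. \<bar>hybrid A z $ i\<bar>)"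
  have "integrable (M1 \<Otimes>\<^sub>M M2) (\<lambda>z. hybrid A z $ i)" for i
    using X[of i] Y[of i] integrable_fst_iff[of "\<lambda>\<omega>. X \<omega> $ i"] integrable_snd_iff[of "\<lambda>\<omega>. Y \<omega> $ i"]
    by (cases "i \<in> A") (simp_all add: merge_vec_def)
  then show "integrable (M1 \<Otimes>\<^sub>M M2) ?b" by simp
  have [measurable]: "f \<in> borel_measurable borel"
    using k_times_cont_diff_imp_continuous[OF f] by (rule borel_measurable_continuous_onI)
  show "(\<lambda>z. f (hybrid A z)) \<in> borel_measurable (M1 \<Otimes>\<^sub>M M2)" by measurable
  have "\<bar>f x\<bar> \<le> \<bar>f 0\<bar> + L * (\<Sum>i\<in>UNIV. \<bar>x $ i\<bar>)" for x
    using abs_diff_zero_le_sum_partial_deriv[OF f L, of x] by linarith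
  then show "AE z in M1 \<Otimes>\<^sub>M M2. norm (f (hybrid A z)) \<le> norm (?b z)"
    by (intro AE_I2) (metis abs_ge_self order_trans real_norm_def)
qed

text \<open>Both hybrids are expanded to second order around \<open>W\<close>. The value at
  \<open>W\<close> cancels, the first and second order differences \<open>D1\<close> and
  \<open>D2\<close> are controlled by \<open>hybrid_moment_bound\<close>, and \<open>R\<close>
  collects the two third order remainders.\<close>

lemma hybrid_replacement_bound:
  fixes f :: "real^'n::{finite,linorder} \<Rightarrow> real"
  assumes A: "\<forall>a\<in>A. a < b" and f: "k_times_cont_diff 3 f"
    and L: "\<And>r i x. r \<in> {1, 2, 3} \<Longrightarrow> \<bar>(partial_deriv i ^^ r) f x\<bar> \<le> L r"
    and X3: "\<And>i. integrable M1 (\<lambda>\<omega>. \<bar>X \<omega> $ i\<bar> ^ 3)"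
    and Y3: "\<And>i. integrable M2 (\<lambda>\<omega>. \<bar>Y \<omega> $ i\<bar> ^ 3)"
  shows "\<bar>expectation (\<lambda>z. f (hybrid (insert b A) z)) - expectation (\<lambda>z. f (hybrid A z))\<bar> \<le>
     M1.expectation (\<lambda>\<omega>. \<bar>real_cond_exp M1 (past_algebra M1 X b) (\<lambda>\<omega>'. X \<omega>' $ b) \<omega>
        - M2.expectation (\<lambda>\<omega>'. Y \<omega>' $ b)\<bar>) * L 1
     + 1/2 * M1.expectation (\<lambda>\<omega>. \<bar>real_cond_exp M1 (past_algebra M1 X b) (\<lambda>\<omega>'. (X \<omega>' $ b)\<^sup>2) \<omega>
        - M2.expectation (\<lambda>\<omega>'. (Y \<omega>' $ b)\<^sup>2)\<bar>) * L 2
     + L 3 / 6 * (M1.expectation (\<lambda>\<omega>. \<bar>X \<omega> $ b\<bar> ^ 3) + M2.expectation (\<lambda>\<omega>. \<bar>Y \<omega> $ b\<bar> ^ 3))"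
proof -
  let ?P = "M1 \<Otimes>\<^sub>M M2"
  have X12: "integrable M1 (\<lambda>\<omega>. X \<omega> $ i)" "integrable M1 (\<lambda>\<omega>. (X \<omega> $ i)\<^sup>2)" for i
    using M1.integrable_power_le[of "\<lambda>\<omega>. X \<omega> $ i" 3 1] M1.integrable_power_le[of "\<lambda>\<omega>. X \<omega> $ i" 3 2] X3
    by auto
  have Y12: "integrable M2 (\<lambda>\<omega>. Y \<omega> $ i)" "integrable M2 (\<lambda>\<omega>. (Y \<omega> $ i)\<^sup>2)" for i
    using M2.integrable_power_le[of "\<lambda>\<omega>. Y \<omega> $ i" 3 1] M2.integrable_power_le[of "\<lambda>\<omega>. Y \<omega> $ i" 3 2] Y3
    by auto
  have "k_times_cont_diff 1 f" using f by (simp add: eval_nat_numeral k_times_cont_diff_imp_continuous)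
  then have fint: "integrable ?P (\<lambda>z. f (hybrid B z))" for B
    using L[of 1] X12 Y12 by (intro integrable_hybrid[of f "L 1"]) auto
  have cont: "continuous_on UNIV ((partial_deriv b ^^ r) f)" if "r \<le> 3" for r
    using k_times_cont_diff_funpow_partial_deriv[of r "3 - r" f b] f that
    by (simp add: k_times_cont_diff_imp_continuous)
  define W where "W = (\<lambda>z. zero_coord b (hybrid A z))"
  define x y where "x = (\<lambda>z :: 'a \<times> 'b. X (fst z) $ b)" and "y = (\<lambda>z :: 'a \<times> 'b. Y (snd z) $ b)"
  define D1 where "D1 = (\<lambda>z. (x z - y z) * partial_deriv b f (W z))"
  define D2 where "D2 = (\<lambda>z. ((x z)\<^sup>2 - (y z)\<^sup>2) * ((partial_deriv b ^^ 2) f (W z) / 2))"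
  define R where "R = (\<lambda>z. f (hybrid (insert b A) z) - f (hybrid A z) - D1 z - D2 z)"
  have g1: "partial_deriv b f \<in> borel_measurable borel"
    using borel_measurable_continuous_onI[OF cont[of 1]] by simp
  \<comment> \<open>The Taylor factor 1/2 is absorbed into the weight, whence the bound
    \<open>L 2 / 2\<close> in \<open>b2\<close>.\<close>
  have g2: "(\<lambda>x. (partial_deriv b ^^ 2) f x / 2) \<in> borel_measurable borel"
    using borel_measurable_continuous_onI[OF cont[of 2]] by simp
  have b1: "\<bar>partial_deriv b f x\<bar> \<le> L 1" and b2: "\<bar>(partial_deriv b ^^ 2) f x / 2\<bar> \<le> L 2 / 2" for x
    using L[of 1 b x] L[of 2 b x] by auto
  have id: "(\<lambda>t::real. t) \<in> borel_measurable borel" and sq: "(\<lambda>t::real. t\<^sup>2) \<in> borel_measurable borel"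
    by auto
  \<comment> \<open>Unfolded to the literal shape of \<open>D\<close> in
    \<open>hybrid_moment_bound\<close>, so that its conclusions fold back to \<open>D1\<close> and
    \<open>D2\<close>.\<close>
  note D1_eq = D1_def[unfolded W_def x_def y_def] and D2_eq = D2_def[unfolded W_def x_def y_def]
  note D1 = hybrid_moment_bound[OF A id g1 X12(1) Y12(1) b1, folded D1_eq]
  note D2 = hybrid_moment_bound[OF A sq g2 X12(2) Y12(2) b2, folded D2_eq]
  have R_int: "integrable ?P R" unfolding R_def using fint D1(1) D2(1) by simp
  have x3: "integrable ?P (\<lambda>z. \<bar>x z\<bar> ^ 3)" "expectation (\<lambda>z. \<bar>x z\<bar> ^ 3) = M1.expectation (\<lambda>\<omega>. \<bar>X \<omega> $ b\<bar> ^ 3)"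
    using X3[of b] integrable_fst_iff[of "\<lambda>\<omega>. \<bar>X \<omega> $ b\<bar> ^ 3"] integral_comp_fst[of "\<lambda>\<omega>. \<bar>X \<omega> $ b\<bar> ^ 3"]
    by (simp_all add: x_def)
  have y3: "integrable ?P (\<lambda>z. \<bar>y z\<bar> ^ 3)" "expectation (\<lambda>z. \<bar>y z\<bar> ^ 3) = M2.expectation (\<lambda>\<omega>. \<bar>Y \<omega> $ b\<bar> ^ 3)"
    using Y3[of b] integrable_snd_iff[of "\<lambda>\<omega>. \<bar>Y \<omega> $ b\<bar> ^ 3"] integral_comp_snd[of "\<lambda>\<omega>. \<bar>Y \<omega> $ b\<bar> ^ 3"]
    by (simp_all add: y_def)
  have R_le: "\<bar>R z\<bar> \<le> L 3 / 6 * (\<bar>x z\<bar> ^ 3 + \<bar>y z\<bar> ^ 3)" for z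
  proof -
    have "b \<notin> A" using A by auto
    then have "hybrid (insert b A) z = W z + x z *\<^sub>R axis b 1" "hybrid A z = W z + y z *\<^sub>R axis b 1"
      using add_scaleR_zero_coord[of b "hybrid (insert b A) z"] add_scaleR_zero_coord[of b "hybrid A z"]
      by (auto simp: W_def zero_coord_merge_vec_insert) (auto simp: x_def y_def merge_vec_def)
    \<comment> \<open>Adding and subtracting \<open>f (W z)\<close> exhibits \<open>R z\<close> as
      the difference of two Taylor remainders, each bounded separately.\<close>
    then have "R z =
        (f (W z + x z *\<^sub>R axis b 1) - f (W z) - x z * partial_deriv b f (W z)
           - (x z)\<^sup>2 * ((partial_deriv b ^^ 2) f (W z) / 2))
      - (f (W z + y z *\<^sub>R axis b 1) - f (W z) - y z * partial_deriv b f (W z)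
           - (y z)\<^sup>2 * ((partial_deriv b ^^ 2) f (W z) / 2))"
      unfolding R_def D1_def D2_def by (simp only: left_diff_distrib)
    also have "\<bar>\<dots>\<bar> \<le> L 3 / 6 * \<bar>x z\<bar> ^ 3 + L 3 / 6 * \<bar>y z\<bar> ^ 3"
      using L[of 3] by (intro order_trans[OF abs_triangle_ineq4] add_mono partial_deriv_Taylor2_bound[OF f]) simp_all
    finally show ?thesis by (simp only: distrib_left)
  qed
  have "\<bar>expectation R\<bar> \<le> expectation (\<lambda>z. \<bar>R z\<bar>)"
    by (rule integral_abs_bound)
  also have "\<dots> \<le> expectation (\<lambda>z. L 3 / 6 * (\<bar>x z\<bar> ^ 3 + \<bar>y z\<bar> ^ 3))"
    using R_int x3 y3 by (intro integral_mono R_le) auto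
  also have "\<dots> = L 3 / 6 * (M1.expectation (\<lambda>\<omega>. \<bar>X \<omega> $ b\<bar> ^ 3) + M2.expectation (\<lambda>\<omega>. \<bar>Y \<omega> $ b\<bar> ^ 3))"
    using x3 y3 by simp
  finally have ER: "\<bar>expectation R\<bar> \<le> \<dots>" .
  have "expectation R = expectation (\<lambda>z. f (hybrid (insert b A) z)) - expectation (\<lambda>z. f (hybrid A z))
      - expectation D1 - expectation D2"
    unfolding R_def using fint D1(1) D2(1) by simp
  then show ?thesis using D1(2) D2(2) ER by (simp only: times_divide_eq_right mult.assoc)
qed

end

section \<open>Telescoping over all coordinates\<close>

theorem theorem1p1:
  fixes M :: "'a measure" and N :: "'b measure"
    and X :: "'a \<Rightarrow> real^'n::{finite,linorder}" and Y :: "'b \<Rightarrow> real^'n::{finite,linorder}"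
    and f :: "real^'n::{finite,linorder} \<Rightarrow> real"
    and A B :: "'n \<Rightarrow> real" and L :: "nat \<Rightarrow> real" and M3 :: real
  assumes "prob_space M" and "prob_space N"
    and "X \<in> borel_measurable M" and "Y \<in> borel_measurable N"
    and "prob_space.indep_vars N (\<lambda>_. borel) (\<lambda>i \<omega>. Y \<omega> $ i) UNIV"
    and "\<And>i. A i = prob_space.expectation M
           (\<lambda>\<omega>. \<bar>real_cond_exp M (past_algebra M X i) (\<lambda>\<omega>'. X \<omega>' $ i) \<omega>
                 - prob_space.expectation N (\<lambda>\<omega>'. Y \<omega>' $ i)\<bar>)"
    and "\<And>i. B i = prob_space.expectation M
           (\<lambda>\<omega>. \<bar>real_cond_exp M (past_algebra M X i) (\<lambda>\<omega>'. (X \<omega>' $ i)\<^sup>2) \<omega>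
                 - prob_space.expectation N (\<lambda>\<omega>'. (Y \<omega>' $ i)\<^sup>2)\<bar>)"
    and "\<And>i. integrable M (\<lambda>\<omega>. \<bar>X \<omega> $ i\<bar> ^ 3)"
    and "\<And>i. integrable N (\<lambda>\<omega>. \<bar>Y \<omega> $ i\<bar> ^ 3)"
    and "\<And>i. prob_space.expectation M (\<lambda>\<omega>. \<bar>X \<omega> $ i\<bar> ^ 3)
             + prob_space.expectation N (\<lambda>\<omega>. \<bar>Y \<omega> $ i\<bar> ^ 3) \<le> M3"
    and "k_times_cont_diff 3 f"
    and "\<And>r i x. r \<in> {1, 2, 3} \<Longrightarrow> \<bar>(partial_deriv i ^^ r) f x\<bar> \<le> L r"
  shows "\<bar>prob_space.expectation M (\<lambda>\<omega>. f (X \<omega>)) - prob_space.expectation N (\<lambda>\<omega>. f (Y \<omega>))\<bar>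
           \<le> (\<Sum>i\<in>UNIV. A i * L 1 + 1/2 * B i * L 2) + 1/6 * real CARD('n) * L 3 * M3"
proof -
  interpret M: prob_space M by fact
  interpret N: prob_space N by fact
  interpret random_vector_pair M N X Y
    by unfold_locales (use assms in auto)
  \<comment> \<open>Any index and point will do: a type is nonempty, which is the condition
    \<open>n \<ge> 1\<close>. The sign of \<open>L 3\<close> is needed when third moments are
    replaced by \<open>M3\<close>.\<close>
  have "\<bar>(partial_deriv undefined ^^ 3) f 0\<bar> \<le> L 3" by (rule assms(12)) simp
  then have L3: "0 \<le> L 3" by linarith
  define c where "c = (\<lambda>i. A i * L 1 + 1/2 * B i * L 2 + L 3 / 6 * M3)"
  have "\<bar>expectation (\<lambda>z. f (hybrid S z)) - expectation (\<lambda>z. f (hybrid {} z))\<bar> \<le> sum c S"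
    if "finite S" for S
    using that
  \<comment> \<open>Each step adds a new maximum \<open>b\<close>, so all coordinates exchanged
    earlier precede \<open>b\<close>, as the one-coordinate bound requires.\<close>
  proof (induction rule: finite_linorder_max_induct)
    case empty
    then show ?case by simp
  next
    case (insert b S)
    have "\<bar>expectation (\<lambda>z. f (hybrid (insert b S) z)) - expectation (\<lambda>z. f (hybrid S z))\<bar>
        \<le> A b * L 1 + 1/2 * B b * L 2
          + L 3 / 6 * (M.expectation (\<lambda>\<omega>. \<bar>X \<omega> $ b\<bar> ^ 3) + N.expectation (\<lambda>\<omega>. \<bar>Y \<omega> $ b\<bar> ^ 3))"
      unfolding assms(6,7) using insert.hyps assms(8-12) by (intro hybrid_replacement_bound) auto
    also have "\<dots> \<le> c b"
      unfolding c_def using L3 assms(10)[of b] by (intro add_left_mono mult_left_mono) auto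
    finally show ?case using insert.IH insert.hyps by (subst sum.insert) auto
  qed
  \<comment> \<open>The hybrid for \<open>UNIV\<close> is \<open>X\<close> and the one for
    \<open>{}\<close> is \<open>Y\<close>; the marginals then return to the original spaces.\<close>
  from this[of UNIV]
  have "\<bar>expectation (\<lambda>z. f (X (fst z))) - expectation (\<lambda>z. f (Y (snd z)))\<bar> \<le> sum c UNIV"
    by (simp add: merge_vec_def)
  moreover have "f \<in> borel_measurable borel"
    using k_times_cont_diff_imp_continuous[OF assms(11)] by (rule borel_measurable_continuous_onI)
  then have "expectation (\<lambda>z. f (X (fst z))) = M.expectation (\<lambda>\<omega>. f (X \<omega>))"
    "expectation (\<lambda>z. f (Y (snd z))) = N.expectation (\<lambda>\<omega>. f (Y \<omega>))"
    using X_meas Y_meas by (auto intro!: integral_comp_fst integral_comp_snd)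
  moreover have "sum c UNIV = (\<Sum>i\<in>UNIV. A i * L 1 + 1/2 * B i * L 2) + 1/6 * real CARD('n) * L 3 * M3"
    unfolding c_def by (simp add: sum.distrib)
  ultimately show ?thesis by simp
qed

end
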